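(* Let $f\colon \mathbb{N}\rightarrow \mathbb{N}$ be a non-decreasing function satisfying $f(n)\geq n+1$ and $f(2n)\leq f(n)^2$ for every $n\in \mathbb{N}$. Then there exists an infinite word $w$ (over some finite alphabet) such that $f\sim p_w$. Moreover, $w$ can be taken to be a recurrent word.
   Context: An infinite word over a finite alphabet $\Sigma$ is a sequence $w=w_0w_1w_2\cdots\in\Sigma^{\mathbb{N}}$. A (finite) factor of $w$ is a finite word of the form $w_iw_{i+1}\cdots w_{i+n-1}$ with $i\ge 0$. The complexity function of $w$ is $p_w(n)=\#\{w_i\cdots w_{i+n-1} \mid i=0,1,2,\dots\}$, the number of distinct factors of $w$ of length $n$. The word $w$ is recurrent if every finite factor of $w$ appears infinitely many times in $w$. For non-decreasing functions $f,g\colon\mathbb{N}\to\mathbb{N}$, write $f\preceq g$ if there are constants $C,D>0$ such that $f(n)\leq C g(Dn)$ for all $n$ (as $g$ is non-decreasing, $D$ may be taken to be a positive integer). Write $f\sim g$ (asymptotic equivalence) if $f\preceq g$ and $g\preceq f$. *)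

theory Defs
  imports Complex_Main "HOL-Library.Omega_Words_Fun"
begin

text \<open>
  Infinite words are functions \<open>nat \<Rightarrow> 'a\<close> (type \<open>'a word\<close>); the finite word
  \<open>w\<^sub>i \<dots> w\<^sub>j\<^sub>-\<^sub>1\<close> is the library's \<open>w [i \<rightarrow> j]\<close>.
\<close>

definition factors_of_length :: "'a word \<Rightarrow> nat \<Rightarrow> 'a list set" where
  "factors_of_length w n = {w [i \<rightarrow> i + n] | i. True}"

text \<open>Meaningful for words over a finite alphabet, where the set of factors is finite.\<close>

definition complexity :: "'a word \<Rightarrow> nat \<Rightarrow> nat" where
  "complexity w n = card (factors_of_length w n)"

definition recurrent :: "'a word \<Rightarrow> bool" where
  "recurrent w \<longleftrightarrow>
    (\<forall>n. \<forall>u \<in> factors_of_length w n. infinite {i. w [i \<rightarrow> i + n] = u})"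

definition growth_le :: "(nat \<Rightarrow> nat) \<Rightarrow> (nat \<Rightarrow> nat) \<Rightarrow> bool" (infix \<open>\<preceq>\<close> 50) where
  "f \<preceq> g \<longleftrightarrow>
    (\<exists>(C::real) (D::nat). C > 0 \<and> D > 0 \<and> (\<forall>n. real (f n) \<le> C * real (g (D * n))))"

definition growth_equiv :: "(nat \<Rightarrow> nat) \<Rightarrow> (nat \<Rightarrow> nat) \<Rightarrow> bool" (infix \<open>\<sim>\<close> 50) where
  "f \<sim> g \<longleftrightarrow> f \<preceq> g \<and> g \<preceq> f"

end

theory Submission
  imports Defs "HOL-Library.Sublist" "HOL-Library.Countable"
begin

text \<open>
  Up to asymptotic equivalence only the values \<open>F k = f (2 ^ k)\<close> matter. They satisfy
  \<open>F k \<le> F (Suc k) \<le> (F k)\<^sup>2\<close> and \<open>F k > 2 ^ k\<close>.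

  The word is built from a hierarchy of finite sets \<open>W\<^sub>i\<close> of \<^emph>\<open>cores\<close>. A core in \<open>W\<^sub>i\<close> has length
  \<open>n\<^sub>i\<close> and starts with a nonzero letter, and in the word it is always followed by at least \<open>n\<^sub>i\<close>
  zeros. Hence a factor of length \<open>n\<^sub>i\<close> sees at most one core of level \<open>i\<close>, and it is determined by
  that core and its position. If \<open>a\<^sub>i\<close> is the number of cores, the complexity near \<open>n\<^sub>i\<close> is therefore
  \<open>n\<^sub>i * a\<^sub>i\<close> up to constants. A core of the next level is a concatenation of a fixed first core and
  \<open>m\<close> blocks, each of which is a core at a freely chosen position in a run of zeros. There are
  \<open>(n\<^sub>i * a\<^sub>i) ^ m\<close> choices of the blocks, and it is this freedom of the positions that makes
  growth up to a power of the complexity itself possible, rather than of the number of cores only.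
  Any subset of these choices may be used as long as each old core survives in some new one, which
  costs only \<open>a\<^sub>i \<le> m * a\<^sub>i\<^sub>+\<^sub>1\<close> (\<open>refinement_exists\<close>, \<open>word_with_levels\<close>).

  The first core of the next level is picked by running through all finite words. So
  each factor sits in the first core at arbitrarily high levels, which makes the language of all
  factors of cores irreducible, and every irreducible factorial language that contains a letter is the
  language of a recurrent word (\<open>word_with_language\<close>).

  It remains to choose the scales \<open>n\<^sub>i\<close> (powers of 2) and the \<open>a\<^sub>i\<close>, so that the complexity is right
  between the scales as well. Two kinds of steps alternate. Starting from a scale \<open>2 ^ k\<close> with
  complexity about \<open>F k\<close>, the first step extends over the stretch on which \<open>F\<close> does not exceed
  \<open>256 * F k\<close> (and over three doublings of the length at least), and uses as few cores as
  possible, so that the complexity remains comparable to \<open>F k\<close>.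
  The second step starts from some \<open>2 ^ l\<close> and complexity \<open>b\<close> and ends at the first
  \<open>2 ^ (l + j)\<close>, \<open>j \<ge> 5\<close>, with \<open>F (l + j) \<le> b ^ 2 ^ (j - 4)\<close>, where the available freedom allows
  the complexity to be \<open>F\<close> up to a constant. Before that point \<open>F (l + s)\<close> is \<open>b ^ 2 ^ s\<close> up to a bounded shift of \<open>s\<close>,
  and so is the complexity: from above by \<open>p (2 * n) \<le> (p n)\<^sup>2\<close> applied upwards from \<open>2 ^ l\<close>, and from
  below by the same inequality applied downwards from \<open>2 ^ (l + j)\<close> (\<open>upper_bound\<close>,
  \<open>lower_bound\<close>). If there is no such \<open>j\<close>, then \<open>f\<close> is equivalent to \<open>2 ^ n\<close>, which is
  the complexity of a word containing all binary words.
\<close>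

section \<open>Recurrent words with a prescribed language\<close>

text \<open>
  The word is the limit of finite words \<open>v i\<close> in \<open>L\<close>, each a prefix of the next. A sequence \<open>e\<close> that
  takes every nonempty word of \<open>L\<close> as a value infinitely often is appended one term at a time, which
  gives recurrence together with the occurrence of all of \<open>L\<close>; irreducibility provides the glue.
\<close>
lemma word_with_language:
  fixes L :: "nat list set"
  assumes factorial: "\<And>u v. v \<in> L \<Longrightarrow> sublist u v \<Longrightarrow> u \<in> L"
    and irreducible: "\<And>u v. u \<in> L \<Longrightarrow> v \<in> L \<Longrightarrow> \<exists>z. u @ z @ v \<in> L"
    and letter: "[x] \<in> L"
  obtains w :: "nat word" where "\<And>n. factors_of_length w n = {u \<in> L. length u = n}" and "recurrent w"
proof -
  define e :: "nat \<Rightarrow> nat list" where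
    "e i = (let u = from_nat (fst (prod_decode i)) in if u \<in> L - {[]} then u else [x])" for i
  have e: "e i \<in> L" "e i \<noteq> []" for i
    using letter by (auto simp: e_def Let_def)
  have e_often: "\<exists>i\<ge>N. e i = u" if "u \<in> L" "u \<noteq> []" for u N
  proof -
    have "e (prod_encode (to_nat u, N)) = u" using that by (simp add: e_def)
    moreover have "N \<le> prod_encode (to_nat u, N)" by (rule le_prod_encode_2)
    ultimately show ?thesis by blast
  qed
  have "\<exists>v. \<forall>i. v i \<in> L \<and> (\<exists>z. v (Suc i) = v i @ z @ e i)"
  proof (rule dependent_nat_choice)
    show "\<exists>v. v \<in> L" using letter by blast
  next
    fix v i assume "v \<in> L"
    then show "\<exists>v'. v' \<in> L \<and> (\<exists>z. v' = v @ z @ e i)"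
      using irreducible e(1) by metis
  qed
  then obtain v where v: "\<And>i. v i \<in> L" "\<And>i. \<exists>z. v (Suc i) = v i @ z @ e i"
    by blast
  have len: "i \<le> length (v i)" for i
  proof (induction i)
    case (Suc i)
    moreover obtain z where "v (Suc i) = v i @ z @ e i" using v(2) by blast
    moreover have "0 < length (e i)" using e(2) by simp
    ultimately show ?case by (simp del: length_greater_0_conv)
  qed simp
  have pre: "prefix (v i) (v j)" if "i \<le> j" for i j
    using that
  proof (induction rule: dec_induct)
    case (step j)
    obtain z where "v (Suc j) = v j @ z @ e j" using v(2) by blast
    then show ?case using step.IH by (simp add: prefix_prefix)
  qed simp
  define w where "w k = v (Suc k) ! k" for k
  have w_nth: "w k = v i ! k" if "k < length (v i)" for k i
  proof -
    have k: "k < length (v (Suc k))" using len[of "Suc k"] by simp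
    consider "i \<le> Suc k" | "Suc k \<le> i" by linarith
    then show ?thesis
      by cases (metis that k pre prefixE nth_append w_def)+
  qed
  have occ: "(w [length p \<rightarrow> length p + length u]) = u" if "v i = p @ u @ q" for i p u q
  proof (rule nth_equalityI)
    fix k assume "k < length (w [length p \<rightarrow> length p + length u])"
    then have k: "k < length u" by simp
    then show "(w [length p \<rightarrow> length p + length u]) ! k = u ! k"
      using w_nth[of "length p + k" i] that by (simp add: nth_append)
  qed simp
  have in_L: "(w [i \<rightarrow> i + n]) \<in> L" for i n
  proof -
    let ?v = "v (i + n)"
    have eq: "?v = take i ?v @ take n (drop i ?v) @ drop (i + n) ?v"
      by (metis append_take_drop_id drop_drop add.commute)
    have l: "length (take i ?v) = i" "length (take n (drop i ?v)) = n"
      using len[of "i + n"] by auto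
    have "(w [i \<rightarrow> i + n]) = take n (drop i ?v)"
      using occ[OF eq] l by simp
    moreover have "sublist (take n (drop i ?v)) ?v"
      using eq by (metis sublist_appendI)
    ultimately show ?thesis using factorial v(1) by metis
  qed
  have often: "infinite {i. (w [i \<rightarrow> i + n]) = u}" if u: "u \<in> L" "length u = n" for u n
  proof (cases "u = []")
    case True
    then show ?thesis using u by simp
  next
    case False
    show ?thesis
      unfolding infinite_nat_iff_unbounded_le
    proof
      fix N
      obtain i where i: "i \<ge> N" "e i = u" using e_often[OF u(1) False] by blast
      obtain z where "v (Suc i) = v i @ z @ u" using v(2) i by metis
      then have "v (Suc i) = (v i @ z) @ u @ []" by simp
      from occ[OF this] have "(w [length (v i @ z) \<rightarrow> length (v i @ z) + n]) = u"
        using u by simp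
      moreover have "N \<le> length (v i @ z)" using len[of i] i by simp
      ultimately show "\<exists>k\<ge>N. k \<in> {i. (w [i \<rightarrow> i + n]) = u}" by blast
    qed
  qed
  have fac: "factors_of_length w n = {u \<in> L. length u = n}" for n
  proof
    show "factors_of_length w n \<subseteq> {u \<in> L. length u = n}"
      using in_L by (auto simp: factors_of_length_def)
    show "{u \<in> L. length u = n} \<subseteq> factors_of_length w n"
    proof
      fix u assume "u \<in> {u \<in> L. length u = n}"
      then have "{i. (w [i \<rightarrow> i + n]) = u} \<noteq> {}"
        using often[of u n] by (metis (mono_tags) finite.emptyI mem_Collect_eq)
      then show "u \<in> factors_of_length w n" by (auto simp: factors_of_length_def)
    qed
  qed
  have "recurrent w"
    unfolding recurrent_def fac using often by blast
  with fac show thesis by (rule that)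
qed

section \<open>Complexity\<close>

lemma finite_factors_of_length:
  assumes "finite \<Sigma>" and "range w \<subseteq> \<Sigma>"
  shows "finite (factors_of_length w n)"
proof (rule finite_subset)
  show "factors_of_length w n \<subseteq> {u. set u \<subseteq> \<Sigma> \<and> length u = n}"
    using assms(2) by (force simp: factors_of_length_def)
  show "finite {u. set u \<subseteq> \<Sigma> \<and> length u = n}"
    using assms(1) by (rule finite_lists_length_eq)
qed

lemma mono_complexity:
  assumes "finite \<Sigma>" and "range w \<subseteq> \<Sigma>"
  shows "mono (complexity w)"
proof (rule monoI)
  fix m n :: nat assume mn: "m \<le> n"
  have "factors_of_length w m \<subseteq> take m ` factors_of_length w n"
  proof
    fix u assume "u \<in> factors_of_length w m"
    then obtain i where "u = (w [i \<rightarrow> i + m])" by (auto simp: factors_of_length_def)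
    then have "u = take m (w [i \<rightarrow> i + n])" using mn by simp
    then show "u \<in> take m ` factors_of_length w n"
      unfolding factors_of_length_def by blast
  qed
  then show "complexity w m \<le> complexity w n"
    unfolding complexity_def
    by (rule surj_card_le[OF finite_factors_of_length[OF assms]])
qed

lemma complexity_double:
  assumes "finite \<Sigma>" and "range w \<subseteq> \<Sigma>"
  shows "complexity w (2 * n) \<le> (complexity w n)\<^sup>2"
proof -
  let ?A = "factors_of_length w n"
  have "factors_of_length w (2 * n) \<subseteq> (\<lambda>(u, v). u @ v) ` (?A \<times> ?A)"
  proof
    fix u assume "u \<in> factors_of_length w (2 * n)"
    then obtain i where "u = (w [i \<rightarrow> i + 2 * n])" by (auto simp: factors_of_length_def)
    then have "u = (w [i \<rightarrow> i + n]) @ (w [i + n \<rightarrow> i + n + n])"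
      using upt_add_eq_append[of i "i + n" n]
      by (simp add: mult_2 add.assoc[symmetric] subsequence_def flip: map_append)
    then show "u \<in> (\<lambda>(u, v). u @ v) ` (?A \<times> ?A)"
      by (auto simp: factors_of_length_def)
  qed
  moreover have "finite ?A" by (rule finite_factors_of_length[OF assms])
  ultimately have "card (factors_of_length w (2 * n)) \<le> card (?A \<times> ?A)"
    by (intro surj_card_le) auto
  then show ?thesis by (simp add: complexity_def card_cartesian_product power2_eq_square)
qed

section \<open>Levels of cores\<close>

text \<open>
  The nonzero first letter makes the start of a core visible behind a run of zeros, so that the
  position of a core can be recovered from the word.
\<close>
definition cores :: "nat set \<Rightarrow> nat \<Rightarrow> nat \<Rightarrow> nat list set \<Rightarrow> bool" where
  "cores \<Sigma> n a W \<longleftrightarrow> finite W \<and> card W = a \<and>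
    (\<forall>c\<in>W. \<exists>x c'. c = x # c' \<and> x \<noteq> 0 \<and> length c = n \<and> set c \<subseteq> \<Sigma>)"

abbreviation zeros :: "nat \<Rightarrow> nat list" where
  "zeros n \<equiv> replicate n 0"

text \<open>
  The core sits at one of \<open>n\<close> positions in a word of length \<open>4 * n\<close>, and at least \<open>n\<close> zeros remain
  on both sides: each core in a concatenation of blocks keeps its distance from its neighbours.
\<close>
definition block :: "nat \<Rightarrow> nat \<Rightarrow> nat list \<Rightarrow> nat list" where
  "block n x c = zeros (n + x) @ c @ zeros (2 * n - x)"

definition blocks :: "nat \<Rightarrow> nat list set \<Rightarrow> nat list set" where
  "blocks n W = (\<lambda>(x, c). block n x c) ` ({..<n} \<times> W)"

text \<open>
  The second condition asks that each core reappear with \<open>n\<close> zeros on both sides, so that all its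
  \<open>n\<close> positions in a window of length \<open>2 * n\<close> are visible, and that it come after \<open>u\<close>, which is
  needed to join an arbitrary factor of \<open>u\<close> to an arbitrary core.
\<close>
definition refines :: "nat \<Rightarrow> nat \<Rightarrow> nat list \<Rightarrow> nat list set \<Rightarrow> nat list set \<Rightarrow> bool" where
  "refines n m u W W' \<longleftrightarrow>
    (\<forall>d\<in>W'. \<exists>ys. ys \<in> lists (blocks n W) \<and> length ys = m \<and> d = u @ zeros (3 * n) @ concat ys) \<and>
    (\<forall>c\<in>W. \<exists>p q. u @ p @ zeros n @ c @ zeros n @ q \<in> W')"

lemma zeros_append_cancel:
  fixes x y :: nat
  assumes "zeros i @ x # c = zeros j @ y # d" and "x \<noteq> 0" and "y \<noteq> 0"
  shows "i = j \<and> x # c = y # d"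
proof -
  have "i = length (takeWhile (\<lambda>z. z = 0) (zeros i @ x # c))" if "x \<noteq> 0" for i x and c :: "nat list"
    using that by (induction i) simp_all
  then have "i = j" using assms by metis
  then show ?thesis using assms by simp
qed


lemma shifted_cores_inject:
  assumes W: "cores \<Sigma> n a W" and "c \<in> W" "d \<in> W"
    and eq: "zeros i @ c @ r = zeros j @ d @ s"
  shows "i = j \<and> c = d"
proof -
  obtain x c' where c: "c = x # c'" "x \<noteq> 0" "length c = n"
    using W \<open>c \<in> W\<close> unfolding cores_def by blast
  obtain y d' where d: "d = y # d'" "y \<noteq> 0" "length d = n"
    using W \<open>d \<in> W\<close> unfolding cores_def by blast
  have "i = j \<and> c @ r = d @ s"
    using zeros_append_cancel[of i x "c' @ r" j y "d' @ s"] eq c d by simp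
  then show ?thesis using c d by simp
qed

lemma card_blocks:
  assumes W: "cores \<Sigma> n a W"
  shows "card (blocks n W) = n * a"
proof -
  have "inj_on (\<lambda>(x, c). block n x c) ({..<n} \<times> W)"
  proof (rule inj_onI, clarify)
    fix x c y d assume "c \<in> W" "d \<in> W" "block n x c = block n y d"
    from shifted_cores_inject[OF W this[unfolded block_def]]
    show "x = y \<and> c = d" by simp
  qed
  then show ?thesis
    using W by (simp add: blocks_def cores_def card_image card_cartesian_product)
qed

lemma blocks_props:
  assumes W: "cores \<Sigma> n a W" and "0 \<in> \<Sigma>" and "b \<in> blocks n W"
  shows "length b = 4 * n" and "set b \<subseteq> \<Sigma>"
proof -
  obtain x c where b: "b = block n x c" "x < n" "c \<in> W"
    using assms(3) unfolding blocks_def by auto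
  then have "length c = n" "set c \<subseteq> \<Sigma>" using W unfolding cores_def by auto
  then show "length b = 4 * n" "set b \<subseteq> \<Sigma>"
    using b assms(2) by (auto simp: block_def)
qed

lemma concat_inject_uniform:
  assumes "concat xs = concat ys" and "length xs = length ys"
    and "\<And>b. b \<in> set xs \<union> set ys \<Longrightarrow> length b = l"
  shows "xs = ys"
proof (rule concat_injective[OF assms(1,2)], clarify)
  fix x y assume "(x, y) \<in> set (zip xs ys)"
  from set_zip_leftD[OF this] set_zip_rightD[OF this]
  have "x \<in> set xs \<union> set ys" "y \<in> set xs \<union> set ys" by simp_all
  then show "length x = length y" by (simp only: assms(3))
qed

text \<open>
  The elements of \<open>W\<close> are dealt out into \<open>r\<close> rows of length \<open>m\<close>; the table is filled cyclically if it
  has more places than \<open>W\<close> has elements.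
\<close>
lemma covering_tuples:
  assumes "finite W" and "W \<noteq> {}" and "card W \<le> m * r"
  obtains V where "finite V" and "card V \<le> r" and "V \<subseteq> {ys \<in> lists W. length ys = m}"
    and "\<And>c. c \<in> W \<Longrightarrow> \<exists>ys\<in>V. c \<in> set ys"
proof -
  obtain g where g: "bij_betw g {0..<card W} W"
    using ex_bij_betw_nat_finite[OF \<open>finite W\<close>] by blast
  have pos: "0 < card W" using assms by (simp add: card_gt_0_iff)
  define row where "row i = map (\<lambda>j. g ((i * m + j) mod card W)) [0..<m]" for i
  have "g (k mod card W) \<in> W" for k
    using g pos by (metis atLeastLessThan_iff bij_betw_apply le0 mod_less_divisor)
  then have 1: "row ` {..<r} \<subseteq> {ys \<in> lists W. length ys = m}"
    by (auto simp: row_def)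
  have 2: "\<exists>ys\<in>row ` {..<r}. c \<in> set ys" if "c \<in> W" for c
  proof -
    obtain k where k: "k < card W" "c = g k"
      using g \<open>c \<in> W\<close> by (metis atLeastLessThan_iff bij_betw_iff_bijections)
    have m: "0 < m" using assms(3) pos by (cases m) auto
    have "c = g ((k div m * m + k mod m) mod card W)" using k by simp
    moreover have "k mod m \<in> set [0..<m]" using m by simp
    ultimately have "c \<in> set (row (k div m))" unfolding row_def by (simp only: set_map image_eqI)
    moreover have "k div m < r"
      using k assms(3) m by (metis less_le_trans mult.commute less_mult_imp_div_less)
    ultimately show ?thesis by blast
  qed
  have "card (row ` {..<r}) \<le> r" using card_image_le[of "{..<r}" row] by simp
  then show thesis using that[OF _ _ 1 2] by simp
qed

text \<open>
  The number \<open>a'\<close> of new cores may be chosen freely between two bounds: covering all old cores takes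
  at least \<open>a / m\<close> new ones, and there are \<open>(n * a) ^ m\<close> tuples of blocks to choose from.
\<close>
lemma refinement_exists:
  assumes W: "cores \<Sigma> n a W" and "0 \<in> \<Sigma>" and n: "0 < n" and u: "u \<in> W"
    and cover: "a \<le> m * a'" and room: "a' \<le> (n * a) ^ m"
  shows "\<exists>W'. refines n m u W W' \<and> cores \<Sigma> (4 * n * (m + 1)) a' W'"
proof -
  have fin: "finite W" and card: "card W = a"
    using W unfolding cores_def by auto
  let ?B = "blocks n W"
  let ?T = "{ys \<in> lists ?B. length ys = m}"
  have finB: "finite ?B" using fin by (simp add: blocks_def)
  have ne: "W \<noteq> {}" and le: "card W \<le> m * a'" using u cover card by auto
  obtain V1 where V1: "finite V1" "card V1 \<le> a'" "V1 \<subseteq> {ys \<in> lists W. length ys = m}"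
    and V1_cover: "\<And>c. c \<in> W \<Longrightarrow> \<exists>ys\<in>V1. c \<in> set ys"
    by (rule covering_tuples[OF fin ne le]) (assumption | rule that)+
  define V0 where "V0 = map (block n 0) ` V1"
  have "card V0 \<le> a'" "finite V0"
    unfolding V0_def using V1 card_image_le[of V1 "map (block n 0)"] by auto
  moreover have "block n 0 c \<in> ?B" if "c \<in> W" for c
    using that n unfolding blocks_def by force
  then have "V0 \<subseteq> ?T" using V1(3) by (fastforce simp: V0_def lists_eq_set)
  moreover have "card ?T = (n * a) ^ m" "finite ?T"
    using card_lists_length_eq[OF finB] finite_lists_length_eq[OF finB] card_blocks[OF W]
    by (simp_all add: lists_eq_set)
  ultimately obtain V where V: "V0 \<subseteq> V" "V \<subseteq> ?T" "card V = a'"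
    using exists_subset_between[of V0 a' ?T] room by metis
  let ?word = "\<lambda>ys. u @ zeros (3 * n) @ concat ys"
  have len: "length b = 4 * n" if "b \<in> ?B" for b using blocks_props[OF W \<open>0 \<in> \<Sigma>\<close> that] by simp
  have "inj_on ?word V"
  proof (rule inj_onI)
    fix xs ys assume "xs \<in> V" "ys \<in> V" "?word xs = ?word ys"
    moreover from this have "xs \<in> ?T" "ys \<in> ?T" using V(2) by auto
    ultimately show "xs = ys"
      by (intro concat_inject_uniform[of xs ys "4 * n"]) (auto intro: len)
  qed
  then have card': "card (?word ` V) = a'" using V(3) by (simp add: card_image)
  have fin': "finite (?word ` V)"
    using V(2) \<open>finite ?T\<close> by (meson finite_imageI finite_subset)
  have "cores \<Sigma> (4 * n * (m + 1)) a' (?word ` V)"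
    unfolding cores_def
  proof (intro conjI fin' card' ballI)
    fix d assume "d \<in> ?word ` V"
    then obtain ys where ys: "ys \<in> ?T" "d = ?word ys" using V(2) by blast
    obtain x c where xc: "u = x # c" "x \<noteq> 0" "length u = n" "set u \<subseteq> \<Sigma>"
      using W u unfolding cores_def by blast
    have "length (concat ys) = 4 * n * length ys" if "ys \<in> lists ?B" for ys
      using that by induction (simp_all add: len)
    then have "length d = 4 * n * (m + 1)" using ys xc by simp
    moreover have "set (concat ys) \<subseteq> \<Sigma>"
    proof -
      have "set b \<subseteq> \<Sigma>" if "b \<in> set ys" for b
        using ys(1) that by (intro blocks_props(2)[OF W \<open>0 \<in> \<Sigma>\<close>]) auto
      then show ?thesis by auto
    qed
    then have "set d \<subseteq> \<Sigma>" using ys xc \<open>0 \<in> \<Sigma>\<close> by auto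
    ultimately show "\<exists>x c. d = x # c \<and> x \<noteq> 0 \<and> length d = 4 * n * (m + 1) \<and> set d \<subseteq> \<Sigma>"
      using ys xc by auto
  qed
  moreover have "refines n m u W (?word ` V)"
    unfolding refines_def
  proof (intro conjI ballI)
    fix d assume "d \<in> ?word ` V"
    then show "\<exists>ys. ys \<in> lists ?B \<and> length ys = m \<and> d = ?word ys" using V(2) by blast
  next
    fix c assume "c \<in> W"
    then obtain ys where ys: "ys \<in> V1" "c \<in> set ys" using V1_cover by blast
    then obtain ys1 ys2 where ys12: "ys = ys1 @ c # ys2" by (auto dest: split_list)
    let ?zs = "map (block n 0) ys"
    have "?zs \<in> V" using V(1) ys by (auto simp: V0_def)
    then have "?word ?zs \<in> ?word ` V" by blast
    moreover have "?word ?zs = u @ (zeros (3 * n) @ concat (map (block n 0) ys1)) @ zeros n @ c @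
        zeros n @ (zeros n @ concat (map (block n 0) ys2))"
    proof -
      have "zeros (2 * n) = zeros n @ zeros n" by (simp add: mult_2 replicate_add)
      then show ?thesis by (simp add: ys12 block_def)
    qed
    ultimately show "\<exists>p q. u @ p @ zeros n @ c @ zeros n @ q \<in> ?word ` V"
      by (simp only:) blast
  qed
  ultimately show ?thesis by blast
qed

section \<open>Sparse words\<close>

text \<open>
  Sparse words are the free monoid generated by the letter 0 and the cores with \<open>n\<close> trailing zeros.
  As a submonoid, the set is preserved when its words are used as cores of a higher level: this
  is why the spacing established at one level persists at all later levels.
\<close>
definition sparse :: "nat \<Rightarrow> nat list set \<Rightarrow> nat list set" where
  "sparse n W = concat ` lists (insert [0] ((\<lambda>c. c @ zeros n) ` W))"

lemma sparse_append: "u \<in> sparse n W \<Longrightarrow> v \<in> sparse n W \<Longrightarrow> u @ v \<in> sparse n W"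
  unfolding sparse_def
proof (elim imageE)
  fix us vs assume "u = concat us" "v = concat vs"
    and "us \<in> lists (insert [0] ((\<lambda>c. c @ zeros n) ` W))"
    and "vs \<in> lists (insert [0] ((\<lambda>c. c @ zeros n) ` W))"
  then show "u @ v \<in> concat ` lists (insert [0] ((\<lambda>c. c @ zeros n) ` W))"
    by (intro image_eqI[of _ _ "us @ vs"]) simp_all
qed

lemma sparse_concat: "vs \<in> lists (sparse n W) \<Longrightarrow> concat vs \<in> sparse n W"
proof (induction rule: lists.induct)
  case Nil
  show ?case unfolding sparse_def by (rule image_eqI[of _ _ "[]"]) simp_all
qed (simp add: sparse_append)

lemma sparse_zeros: "zeros k \<in> sparse n W"
proof -
  have "zeros k = concat (replicate k [0])" by (induction k) simp_all
  then show ?thesis unfolding sparse_def by (intro image_eqI[of _ _ "replicate k [0]"]) auto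
qed

lemma sparse_core: "c \<in> W \<Longrightarrow> c @ zeros n \<in> sparse n W"
  unfolding sparse_def by (rule image_eqI[of _ _ "[c @ zeros n]"]) simp_all

lemma sparse_core_zeros: "c \<in> W \<Longrightarrow> n \<le> k \<Longrightarrow> c @ zeros k \<in> sparse n W"
  using sparse_append[OF sparse_core sparse_zeros, of c W n "k - n"]
    replicate_add[of n "k - n" "0::nat"] by simp

lemma refines_sparse:
  assumes "refines n m u W W'" and "u \<in> W"
  shows "W' \<subseteq> sparse n W"
proof
  fix d assume "d \<in> W'"
  then obtain ys where ys: "ys \<in> lists (blocks n W)" "d = (u @ zeros (3 * n)) @ concat ys"
    using assms(1) unfolding refines_def append_assoc by blast
  have "block n x c \<in> sparse n W" if "x < n" "c \<in> W" for x c
    unfolding block_def using that by (intro sparse_append sparse_zeros sparse_core_zeros) simp_all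
  then have "blocks n W \<subseteq> sparse n W" unfolding blocks_def by auto
  then have "concat ys \<in> sparse n W" using ys(1) by (metis lists_mono sparse_concat subsetD)
  then show "d \<in> sparse n W"
    unfolding ys(2) using assms(2) by (intro sparse_append sparse_core_zeros) simp_all
qed

lemma sparse_subset:
  assumes "W' \<subseteq> sparse n W"
  shows "sparse n' W' \<subseteq> sparse n W"
proof
  fix v assume "v \<in> sparse n' W'"
  then obtain vs where vs: "v = concat vs" "vs \<in> lists (insert [0] ((\<lambda>c. c @ zeros n') ` W'))"
    unfolding sparse_def by blast
  have "c @ zeros n' \<in> sparse n W" if "c \<in> W'" for c
    using that assms by (intro sparse_append sparse_zeros) blast
  then have "insert [0] ((\<lambda>c. c @ zeros n') ` W') \<subseteq> sparse n W"
    using sparse_zeros[of 1 n W] by auto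
  then have "vs \<in> lists (sparse n W)" using vs(2) by (metis lists_mono subsetD)
  then show "v \<in> sparse n W" unfolding vs(1) by (rule sparse_concat)
qed

text \<open>
  This is the part of the window argument that concerns the right end: a short prefix of a sparse
  word runs through zeros and then enters at most one core.
\<close>
lemma prefix_sparse:
  assumes "v \<in> sparse n W" and "Sublist.prefix s v" and "length s \<le> n" and "W \<noteq> {}"
  shows "\<exists>x. \<exists>c\<in>W. x \<le> length s \<and> Sublist.prefix s (zeros x @ c @ zeros n)"
proof -
  obtain vs where vs: "v = concat vs" "vs \<in> lists (insert [0] ((\<lambda>c. c @ zeros n) ` W))"
    using assms(1) unfolding sparse_def by blast
  show ?thesis
    using vs(2) assms(2,3) unfolding vs(1)
  proof (induction arbitrary: s rule: lists.induct)
    case Nil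
    then show ?case using \<open>W \<noteq> {}\<close> by auto
  next
    case (Cons p vs)
    show ?case
    proof (cases "s = []")
      case True
      then show ?thesis using \<open>W \<noteq> {}\<close> by auto
    next
      case False
      consider "p = [0]" | c where "c \<in> W" "p = c @ zeros n" using Cons.hyps(1) by blast
      then show ?thesis
      proof cases
        case 1
        then obtain s' where s': "s = 0 # s'" "Sublist.prefix s' (concat vs)"
          using Cons.prems(1) False by (cases s) auto
        then obtain x c where xc: "c \<in> W" "x \<le> length s'"
          "Sublist.prefix s' (zeros x @ c @ zeros n)"
          using Cons.IH[of s'] Cons.prems(2) by auto
        then have "Sublist.prefix s (zeros (Suc x) @ c @ zeros n)" using s'(1) by simp
        then show ?thesis using xc s'(1) by (metis Suc_le_mono length_Cons)
      next
        case 2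
        then have "Sublist.prefix s (c @ zeros n)"
          using Cons.prems by (auto intro!: prefix_length_prefix[of s _ "c @ zeros n"])
        then show ?thesis using 2 by (auto intro!: exI[of _ 0])
      qed
    qed
  qed
qed

text \<open>
  A window of length \<open>n\<close> cannot meet two different cores, because \<open>n\<close> zeros lie between them.
\<close>
lemma sublist_sparse:
  assumes "v \<in> sparse n W" and "sublist s v" and "length s \<le> n" and "W \<noteq> {}"
  shows "\<exists>c\<in>W. sublist s (zeros n @ c @ zeros n)"
proof -
  obtain vs where vs: "v = concat vs" "vs \<in> lists (insert [0] ((\<lambda>c. c @ zeros n) ` W))"
    using assms(1) unfolding sparse_def by blast
  show ?thesis
    using vs(2) assms(2) unfolding vs(1)
  proof (induction rule: lists.induct)
    case Nil
    then show ?case using \<open>W \<noteq> {}\<close> by auto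
  next
    case (Cons p vs)
    have vs_sparse: "concat vs \<in> sparse n W" using Cons.hyps(2) by (auto simp: sparse_def)
    have p: "p = [0] \<or> (\<exists>c\<in>W. p = c @ zeros n)" using Cons.hyps(1) by blast
    consider "sublist s p" | "sublist s (concat vs)"
      | s1 s2 where "s = s1 @ s2" "Sublist.suffix s1 p" "Sublist.prefix s2 (concat vs)"
      using Cons.prems by (auto simp: sublist_append)
    then show ?case
    proof cases
      case 1
      show ?thesis
      proof (cases "p = [0]")
        case True
        obtain c where "c \<in> W" using \<open>W \<noteq> {}\<close> by blast
        moreover have "sublist s (zeros n)"
        proof (cases "s = []")
          case False
          then have "s = [0]" using 1 True by (auto simp: sublist_Cons_right prefix_Cons)
          moreover have "zeros n = [0] @ zeros (n - 1)"
            using assms(3) \<open>s = [0]\<close> by (cases n) auto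
          ultimately show ?thesis using sublist_append_rightI[of "[0]"] by metis
        qed simp
        ultimately show ?thesis by (auto simp: sublist_append)
      next
        case False
        then obtain c where "c \<in> W" "p = c @ zeros n" using p by blast
        then have "sublist s (zeros n @ c @ zeros n)" using 1 sublist_append by blast
        then show ?thesis using \<open>c \<in> W\<close> by blast
      qed
    next
      case 2
      then show ?thesis by (rule Cons.IH)
    next
      case 3
      obtain x c where xc: "c \<in> W" "x \<le> length s2" "Sublist.prefix s2 (zeros x @ c @ zeros n)"
        using prefix_sparse[OF vs_sparse 3(3) _ \<open>W \<noteq> {}\<close>] 3(1) assms(3) by auto
      have "set s1 \<subseteq> {0}"
        using p
      proof (elim disjE bexE)
        assume "p = [0]"
        then have "set p = {0}" by simp
        then show ?thesis by (rule subst) (rule set_mono_suffix[OF 3(2)])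
      next
        fix c assume "p = c @ zeros n"
        then have "Sublist.suffix s1 (c @ zeros n)" using 3(2) by simp
        moreover have "Sublist.suffix (zeros n) (c @ zeros n)" by (rule Sublist.suffixI) (rule refl)
        moreover have "length s1 \<le> length (zeros n)" using 3(1) assms(3) by simp
        ultimately have "Sublist.suffix s1 (zeros n)" by (rule suffix_length_suffix)
        from set_mono_suffix[OF this] show ?thesis by auto
      qed
      then have "s1 = zeros (length s1)" by (intro replicate_eqI refl) blast
      then have "Sublist.prefix s (zeros (length s1) @ zeros x @ c @ zeros n)"
        using 3(1) xc(3) by (metis same_prefix_prefix)
      then have "Sublist.prefix s (zeros (length s1 + x) @ c @ zeros n)"
        by (simp add: replicate_add)
      then have "sublist s (zeros (n - (length s1 + x)) @ zeros (length s1 + x) @ c @ zeros n)"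
        using prefix_imp_sublist sublist_append by blast
      moreover have "length s1 + x \<le> n" using xc(2) 3(1) assms(3) by simp
      ultimately have "sublist s (zeros n @ c @ zeros n)"
        by (simp flip: append_assoc replicate_add)
      then show ?thesis using xc(1) by blast
    qed
  qed
qed

text \<open>
  A window of length \<open>n\<close> into a word of length \<open>3 * n\<close> has \<open>2 * n + 1 \<le> 3 * n\<close> positions.
\<close>
lemma card_short_factors_sparse:
  assumes W: "cores \<Sigma> n a W" and "0 < n"
    and S: "\<And>s. s \<in> S \<Longrightarrow> length s = n \<and> (\<exists>c\<in>W. sublist s (zeros n @ c @ zeros n))"
  shows "card S \<le> 3 * (n * a)"
proof -
  have fin: "finite W" "card W = a" using W unfolding cores_def by auto
  let ?f = "\<lambda>(i, c). take n (drop i (zeros n @ c @ zeros n))"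
  have "S \<subseteq> ?f ` ({..2 * n} \<times> W)"
  proof
    fix s assume "s \<in> S"
    then obtain c where s: "length s = n" "c \<in> W" "sublist s (zeros n @ c @ zeros n)"
      using S by blast
    then obtain p q where pq: "zeros n @ c @ zeros n = p @ s @ q"
      unfolding sublist_def by blast
    have "length c = n" using W s(2) unfolding cores_def by auto
    then have "length p \<le> 2 * n"
      using arg_cong[OF pq, of length] s(1) by simp
    moreover have "s = ?f (length p, c)" unfolding prod.case pq using s(1) by simp
    ultimately show "s \<in> ?f ` ({..2 * n} \<times> W)" using s(2) by blast
  qed
  then have "card S \<le> card ({..2 * n} \<times> W)" using fin by (intro surj_card_le) auto
  also have "\<dots> = (2 * n + 1) * a" using fin by (simp add: card_cartesian_product)
  also have "\<dots> \<le> 3 * n * a" using \<open>0 < n\<close> by (intro mult_right_mono) auto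
  finally show ?thesis by simp
qed

section \<open>A word with given numbers of cores\<close>

lemma cores_exist:
  assumes "0 < n"
  shows "\<exists>W. cores {..a} n a W"
proof
  let ?core = "\<lambda>x. x # zeros (n - 1)"
  have "inj_on ?core {1..a}" by (rule inj_onI) simp
  then show "cores {..a} n a (?core ` {1..a})"
    using assms by (auto simp: cores_def card_image)
qed

text \<open>
  The complexity at the scale \<open>n i\<close> is governed by the product of length and number of cores. The
  two lower bounds serve different purposes: the first counts positions of cores and is sharp near
  the scale \<open>n i\<close>, the second counts cores alone, at no loss in the length, and is good enough when
  \<open>a i\<close> is much larger than \<open>n i\<close>.
\<close>
theorem word_with_levels:
  fixes n a m :: "nat \<Rightarrow> nat"
  assumes n0: "0 < n 0" and n_Suc: "\<And>i. n (Suc i) = 4 * n i * (m i + 1)"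
    and a_pos: "\<And>i. 0 < a i"
    and cover: "\<And>i. a i \<le> m i * a (Suc i)"
    and room: "\<And>i. a (Suc i) \<le> (n i * a i) ^ m i"
  shows "\<exists>(\<Sigma> :: nat set) (w :: nat word). finite \<Sigma> \<and> range w \<subseteq> \<Sigma> \<and> recurrent w \<and>
    (\<forall>i. complexity w (n i) \<le> 3 * (n i * a i) \<and>
      n i * a i \<le> complexity w (2 * n i) \<and> a i \<le> complexity w (n i))"
proof -
  define \<Sigma> where "\<Sigma> = {..a 0}"
  have n_pos: "0 < n i" for i by (induction i) (simp_all add: n0 n_Suc)
  define e :: "nat \<Rightarrow> nat list" where "e i = from_nat (fst (prod_decode i))" for i
  have e_often: "\<exists>j\<ge>i. e j = u" for u i
  proof (intro exI conjI)
    show "i \<le> prod_encode (to_nat u, i)" by (rule le_prod_encode_2)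
  qed (simp add: e_def)
  \<comment> \<open>The common first core \<open>u\<close> contains \<open>e i\<close> whenever \<open>e i\<close> is a factor of some core.\<close>
  let ?next = "\<lambda>i W W'. \<exists>u\<in>W. ((\<exists>c\<in>W. sublist (e i) c) \<longrightarrow> sublist (e i) u) \<and>
    refines (n i) (m i) u W W'"
  have "\<exists>W. \<forall>i. cores \<Sigma> (n i) (a i) (W i) \<and> ?next i (W i) (W (Suc i))"
  proof (rule dependent_nat_choice)
    show "\<exists>W. cores \<Sigma> (n 0) (a 0) W" unfolding \<Sigma>_def using cores_exist[OF n0] .
  next
    fix W i assume W: "cores \<Sigma> (n i) (a i) W"
    then have "W \<noteq> {}" using a_pos[of i] by (auto simp: cores_def)
    then obtain u where u: "u \<in> W" "(\<exists>c\<in>W. sublist (e i) c) \<longrightarrow> sublist (e i) u" by blast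
    have "0 \<in> \<Sigma>" by (simp add: \<Sigma>_def)
    from refinement_exists[OF W this n_pos u(1) cover room]
    show "\<exists>W'. cores \<Sigma> (n (Suc i)) (a (Suc i)) W' \<and> ?next i W W'"
      unfolding n_Suc using u by blast
  qed
  then obtain W where W: "\<And>i. cores \<Sigma> (n i) (a i) (W i)" and next_W: "\<And>i. ?next i (W i) (W (Suc i))"
    by blast
  have W_ne: "W i \<noteq> {}" for i using W[of i] a_pos[of i] by (auto simp: cores_def)
  have W_len: "length c = n i" and W_alph: "set c \<subseteq> \<Sigma>" if "c \<in> W i" for c i
    using W[of i] that unfolding cores_def by blast+
  have lift: "\<exists>d\<in>W j. sublist c d" if "c \<in> W i" "i \<le> j" for c i j
    using that(2)
  proof (induction rule: dec_induct)
    case base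
    show ?case using \<open>c \<in> W i\<close> by blast
  next
    case (step j)
    then obtain d where d: "d \<in> W j" "sublist c d" by blast
    obtain u where "refines (n j) (m j) u (W j) (W (Suc j))" using next_W[of j] by blast
    then obtain p q where "u @ p @ zeros (n j) @ d @ zeros (n j) @ q \<in> W (Suc j)"
      using d(1) unfolding refines_def by blast
    moreover have "sublist c (u @ p @ zeros (n j) @ d @ zeros (n j) @ q)"
      using d(2) by (simp add: sublist_append)
    ultimately show ?case by blast
  qed
  have W_sparse: "W (Suc j) \<subseteq> sparse (n i) (W i)" if "i \<le> j" for i j
    using that
  proof (induction rule: dec_induct)
    case base
    show ?case using next_W[of i] refines_sparse by blast
  next
    case (step j)
    have "W (Suc (Suc j)) \<subseteq> sparse (n (Suc j)) (W (Suc j))"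
      using next_W[of "Suc j"] refines_sparse by blast
    then show ?case using sparse_subset[OF step.IH] by blast
  qed
  define L where "L = {u. \<exists>i. \<exists>c\<in>W i. sublist u c}"
  have W_L: "c \<in> L" if "c \<in> W i" for c i using that unfolding L_def by blast
  have L_sparse: "\<exists>d\<in>sparse (n i) (W i). sublist u d" if "u \<in> L" for u i
  proof -
    obtain j c where c: "c \<in> W j" "sublist u c" using \<open>u \<in> L\<close> unfolding L_def by blast
    obtain d where d: "d \<in> W (Suc (max i j))" "sublist c d" 
      using lift[OF c(1) le_SucI[OF max.cobounded2]] by blast
    have "d \<in> sparse (n i) (W i)" using W_sparse[of i "max i j"] d(1) by auto
    then show ?thesis using c(2) d(2) by (meson sublist_order.order_trans)
  qed
  have factorial: "u \<in> L" if "v \<in> L" "sublist u v" for u v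
    using that unfolding L_def by (blast intro: sublist_order.order_trans)
  \<comment> \<open>To join \<open>u\<close> to \<open>v\<close>, take a level \<open>k\<close> at which the first core is chosen to contain \<open>u\<close> and at which
      \<open>v\<close> occurs in a core \<open>d'\<close>; some core of the next level contains \<open>d'\<close> after the first core.\<close>
  have irreducible: "\<exists>z. u @ z @ v \<in> L" if "u \<in> L" "v \<in> L" for u v
  proof -
    obtain i c where c: "c \<in> W i" "sublist u c" using \<open>u \<in> L\<close> unfolding L_def by blast
    obtain j d where d: "d \<in> W j" "sublist v d" using \<open>v \<in> L\<close> unfolding L_def by blast
    obtain k where k: "k \<ge> max i j" "e k = u" using e_often by blast
    obtain c' where c': "c' \<in> W k" "sublist u c'"
      using lift[OF c(1), of k] c(2) k(1) by (auto intro: sublist_order.order_trans)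
    obtain d' where d': "d' \<in> W k" "sublist v d'"
      using lift[OF d(1), of k] d(2) k(1) by (auto intro: sublist_order.order_trans)
    obtain b where b: "sublist u b" "refines (n k) (m k) b (W k) (W (Suc k))"
      using next_W[of k] c' k(2) by blast
    obtain p q where pq: "b @ p @ zeros (n k) @ d' @ zeros (n k) @ q \<in> W (Suc k)"
      using b(2) d'(1) unfolding refines_def by blast
    obtain b1 b2 where b12: "b = b1 @ u @ b2" using b(1) unfolding sublist_def by blast
    obtain d1 d2 where d12: "d' = d1 @ v @ d2" using d'(2) unfolding sublist_def by blast
    let ?w = "u @ (b2 @ p @ zeros (n k) @ d1) @ v"
    have "b @ p @ zeros (n k) @ d' @ zeros (n k) @ q = b1 @ ?w @ (d2 @ zeros (n k) @ q)"
      unfolding b12 d12 by simp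
    then have "sublist ?w (b @ p @ zeros (n k) @ d' @ zeros (n k) @ q)"
      unfolding sublist_def by blast
    then have "?w \<in> L" using factorial W_L[OF pq] by blast
    then show ?thesis by blast
  qed
  obtain c where "c \<in> W 0" using W_ne by blast
  then obtain x c' where "c = [x] @ c'" using W[of 0] unfolding cores_def by force
  then have x: "[x] \<in> L" using factorial[OF W_L[OF \<open>c \<in> W 0\<close>]] by (metis sublist_append_rightI)
  obtain w
    where w: "\<And>k. factors_of_length w k = {u \<in> L. length u = k}" and rec: "recurrent w"
  proof (rule word_with_language[of L x])
    show "u \<in> L" if "v \<in> L" "sublist u v" for u v using that by (rule factorial)
    show "\<exists>z. u @ z @ v \<in> L" if "u \<in> L" "v \<in> L" for u v using that by (rule irreducible)
    show "[x] \<in> L" by (rule x)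
  qed auto
  have "range w \<subseteq> \<Sigma>"
  proof
    fix y assume "y \<in> range w"
    then obtain i where "y = w i" by blast
    moreover have "(w [i \<rightarrow> i + 1]) \<in> factors_of_length w 1" by (auto simp: factors_of_length_def)
    ultimately have "[y] \<in> L" unfolding w by simp
    then obtain j c where "c \<in> W j" "sublist [y] c" unfolding L_def by blast
    then show "y \<in> \<Sigma>" using W_alph set_mono_sublist by fastforce
  qed
  moreover have "finite \<Sigma>" by (simp add: \<Sigma>_def)
  moreover have "complexity w (n i) \<le> 3 * (n i * a i)" for i
    unfolding complexity_def w
  proof (rule card_short_factors_sparse[OF W n_pos])
    fix s assume "s \<in> {u \<in> L. length u = n i}"
    then have s: "s \<in> L" "length s = n i" by auto
    obtain d where d: "d \<in> sparse (n i) (W i)" "sublist s d" using L_sparse[OF s(1)] by blast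
    have "length s \<le> n i" using s(2) by simp
    from sublist_sparse[OF d this W_ne] s(2)
    show "length s = n i \<and> (\<exists>c\<in>W i. sublist s (zeros (n i) @ c @ zeros (n i)))" by simp
  qed
  moreover have "n i * a i \<le> complexity w (2 * n i)" for i
  proof -
    let ?f = "\<lambda>(x, c). zeros x @ c @ zeros (n i - x)"
    have "inj_on ?f ({..<n i} \<times> W i)"
    proof (rule inj_onI, clarify)
      fix x c y d assume "c \<in> W i" "d \<in> W i" "zeros x @ c @ zeros (n i - x) = zeros y @ d @ zeros (n i - y)"
      from shifted_cores_inject[OF W this] show "x = y \<and> c = d" .
    qed
    then have "card (?f ` ({..<n i} \<times> W i)) = n i * a i"
      using W[of i] by (simp add: cores_def card_image card_cartesian_product)
    moreover
    have "?f ` ({..<n i} \<times> W i) \<subseteq> factors_of_length w (2 * n i)"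
      unfolding w
    proof clarify
      fix x c assume x: "x < n i" and c: "c \<in> W i"
      obtain u where "refines (n i) (m i) u (W i) (W (Suc i))" using next_W[of i] by blast
      then obtain p q where pq: "u @ p @ zeros (n i) @ c @ zeros (n i) @ q \<in> W (Suc i)"
        using c unfolding refines_def by blast
      have "zeros (n i) = zeros (n i - x) @ zeros x"
        using x by (simp flip: replicate_add)
      then have "u @ p @ zeros (n i) @ c @ zeros (n i) @ q =
          u @ p @ (zeros (n i - x) @ zeros x) @ c @ (zeros (n i - x) @ zeros x) @ q"
        by (simp only:)
      then have "u @ p @ zeros (n i) @ c @ zeros (n i) @ q =
          (u @ p @ zeros (n i - x)) @ (zeros x @ c @ zeros (n i - x)) @ (zeros x @ q)"
        by (simp only: append_assoc)
      then have "sublist (zeros x @ c @ zeros (n i - x)) (u @ p @ zeros (n i) @ c @ zeros (n i) @ q)"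
        unfolding sublist_def by blast
      then have "zeros x @ c @ zeros (n i - x) \<in> L" using factorial W_L[OF pq] by blast
      moreover have "length (zeros x @ c @ zeros (n i - x)) = 2 * n i" using x W_len[OF c] by simp
      ultimately show "zeros x @ c @ zeros (n i - x) \<in> L \<and>
        length (zeros x @ c @ zeros (n i - x)) = 2 * n i" by blast
    qed
    from card_mono[OF finite_factors_of_length[OF \<open>finite \<Sigma>\<close> \<open>range w \<subseteq> \<Sigma>\<close>] this]
    have "card (?f ` ({..<n i} \<times> W i)) \<le> complexity w (2 * n i)"
      unfolding complexity_def .
    ultimately show ?thesis by simp
  qed
  moreover have "a i \<le> complexity w (n i)" for i
  proof -
    have "W i \<subseteq> factors_of_length w (n i)" unfolding w using W_L W_len by blast
    then have "card (W i) \<le> complexity w (n i)"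
      unfolding complexity_def
      by (rule card_mono[OF finite_factors_of_length[OF \<open>finite \<Sigma>\<close> \<open>range w \<subseteq> \<Sigma>\<close>]])
    then show ?thesis using W[of i] by (simp add: cores_def)
  qed
  ultimately show ?thesis using rec by (intro exI[of _ \<Sigma>] exI[of _ w] conjI allI)
qed

lemma full_binary_word:
  obtains w :: "nat word" where "range w \<subseteq> {0, 1}" and "recurrent w"
    and "\<And>n. complexity w n = 2 ^ n"
proof -
  let ?L = "lists {0, 1 :: nat}"
  obtain w where w: "\<And>n. factors_of_length w n = {u \<in> ?L. length u = n}" and rec: "recurrent w"
  proof (rule word_with_language[of ?L 0])
    fix u v assume "v \<in> ?L" "sublist u v"
    then show "u \<in> ?L" using set_mono_sublist[of u v] by (auto simp: lists_eq_set)
  next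
    fix u v assume "u \<in> ?L" "v \<in> ?L"
    then show "\<exists>z. u @ z @ v \<in> ?L" by (intro exI[of _ "[]"]) simp
  qed auto
  have "w i \<in> {0, 1}" for i
  proof -
    have "(w [i \<rightarrow> i + 1]) \<in> factors_of_length w 1" by (auto simp: factors_of_length_def)
    then show ?thesis unfolding w by simp
  qed
  moreover have "complexity w n = 2 ^ n" for n
    unfolding complexity_def w using card_lists_length_eq[of "{0, 1 :: nat}" n]
    by (simp add: lists_eq_set numeral_2_eq_2)
  ultimately show thesis using rec by (intro that) blast+
qed

section \<open>Choosing the scales\<close>

text \<open>
  Both the desired growth and the complexity of a word satisfy the hypothesis when they are read
  off at powers of 2.
\<close>
lemma iterated_square:
  fixes G :: "nat \<Rightarrow> nat"
  assumes "\<And>k. G (Suc k) \<le> (G k)\<^sup>2"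
  shows "G (k + s) \<le> G k ^ 2 ^ s"
proof (induction s)
  case (Suc s)
  have "G (k + Suc s) \<le> (G (k + s))\<^sup>2" using assms by simp
  also have "\<dots> \<le> (G k ^ 2 ^ s)\<^sup>2" using Suc by (rule power_mono) simp
  finally show ?case by (simp add: mult.commute flip: power_mult)
qed simp

text \<open>
  Here \<open>F k\<close> is the desired complexity at length \<open>2 ^ k\<close>. The last assumption excludes
  the exponential functions, for which a growth step might never end.
\<close>
locale growth =
  fixes F :: "nat \<Rightarrow> nat"
  assumes step_mono: "F k \<le> F (Suc k)"
    and square: "F (Suc k) \<le> (F k)\<^sup>2"
    and lower: "2 ^ k < F k"
    and subexponential: "\<exists>s. F (s + c) < 2 ^ 2 ^ s"
begin

lemma F_mono: "k \<le> l \<Longrightarrow> F k \<le> F l"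
  by (rule lift_Suc_mono_le[of F]) (rule step_mono)

text \<open>
  The number of cores of length \<open>2 ^ k\<close> for which the complexity at \<open>2 ^ k\<close> is \<open>F k\<close>, up to a factor
  of 2 due to rounding.
\<close>
definition count :: "nat \<Rightarrow> nat" where
  "count k = F k div 2 ^ k"

lemma count_pos: "0 < count k"
  using lower[of k] by (simp add: count_def div_greater_zero_iff)

lemma count_le: "2 ^ k * count k \<le> F k"
  by (simp add: count_def)

lemma count_ge: "F k \<le> 2 * (2 ^ k * count k)"
proof -
  have "F k < 2 ^ k * (count k + 1)"
    using dividend_less_times_div[of "2 ^ k" "F k"] by (simp add: count_def)
  also have "\<dots> \<le> 2 ^ k * (2 * count k)" using count_pos[of k] by (intro mult_le_mono2) simp
  finally show ?thesis by simp
qed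

text \<open>
  The end of a stretch on which \<open>F\<close> is essentially constant. At least three doublings are needed
  to make room for a refinement. The factor 256 pays for covering in the growth step that follows:
  in the bound \<open>flat_total_le\<close> for the complexity \<open>b\<close> at the end of the stretch the summand \<open>8 * F k\<close>
  appears, and half of the next value of \<open>F\<close> has to exceed 16 times this summand.
\<close>
definition flat_end :: "nat \<Rightarrow> nat" where
  "flat_end k = (LEAST l. k + 3 \<le> l \<and> 256 * F k \<le> F (Suc l))"

lemma flat_end_exists: "\<exists>l. k + 3 \<le> l \<and> 256 * F k \<le> F (Suc l)"
proof (intro exI conjI)
  let ?l = "k + 3 + 256 * F k"
  show "k + 3 \<le> ?l" by simp
  have "256 * F k \<le> 2 ^ ?l" using less_exp[of ?l] by linarith
  also have "\<dots> \<le> F (Suc ?l)" using lower[of ?l] step_mono[of ?l] by linarith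
  finally show "256 * F k \<le> F (Suc ?l)" .
qed

lemma flat_end: "k + 3 \<le> flat_end k" "256 * F k \<le> F (Suc (flat_end k))"
  using LeastI_ex[OF flat_end_exists, of k] unfolding flat_end_def by auto

lemma flat_end_cases: "flat_end k = k + 3 \<or> F (flat_end k) < 256 * F k"
proof (rule ccontr)
  assume *: "\<not> ?thesis"
  then obtain l where l: "flat_end k = Suc l" "k + 3 \<le> l" using flat_end(1)[of k] by (cases "flat_end k") auto
  then have "l < (LEAST l. k + 3 \<le> l \<and> 256 * F k \<le> F (Suc l))" unfolding flat_end_def by simp
  from not_less_Least[OF this] show False using * l by simp
qed

text \<open>
  About the smallest number of cores that can cover those at scale \<open>2 ^ k\<close>; \<open>flat_total\<close> is the
  resulting complexity.
\<close>
definition flat_count :: "nat \<Rightarrow> nat" where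
  "flat_count k = count k div 2 ^ (flat_end k - (k + 3)) + 1"

definition flat_total :: "nat \<Rightarrow> nat" where
  "flat_total k = 2 ^ flat_end k * flat_count k"

lemma count_le_flat_count: "count k \<le> 2 ^ (flat_end k - (k + 3)) * flat_count k"
  using dividend_less_times_div[of "2 ^ (flat_end k - (k + 3))" "count k"]
  by (simp add: flat_count_def)

lemma flat_end_power: "2 ^ flat_end k = 8 * 2 ^ k * (2::nat) ^ (flat_end k - (k + 3))"
proof -
  have "flat_end k = 3 + k + (flat_end k - (k + 3))" using flat_end(1)[of k] by simp
  then have "2 ^ flat_end k = (2::nat) ^ (3 + k + (flat_end k - (k + 3)))" by simp
  then show ?thesis by (simp add: power_add)
qed

lemma flat_total_ge: "4 * F k \<le> flat_total k"
proof -
  have "4 * F k \<le> 8 * 2 ^ k * count k" using count_ge[of k] unfolding mult.assoc by linarith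
  also have "\<dots> \<le> 8 * 2 ^ k * (2 ^ (flat_end k - (k + 3)) * flat_count k)"
    by (rule mult_le_mono2[OF count_le_flat_count])
  also have "\<dots> = flat_total k" by (simp add: flat_total_def flat_end_power)
  finally show ?thesis .
qed

lemma flat_total_le: "flat_total k \<le> 8 * F k + 2 ^ flat_end k"
proof -
  let ?t = "flat_end k - (k + 3)"
  have "flat_total k = 8 * 2 ^ k * (2 ^ ?t * (count k div 2 ^ ?t)) + 2 ^ flat_end k"
    by (simp add: flat_total_def flat_count_def flat_end_power algebra_simps)
  also have "\<dots> \<le> 8 * 2 ^ k * count k + 2 ^ flat_end k"
    by (intro add_mono mult_le_mono2 order_refl) simp
  also have "\<dots> \<le> 8 * F k + 2 ^ flat_end k" using count_le[of k] by simp
  finally show ?thesis .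
qed

lemma flat_total_ge_8: "8 \<le> flat_total k"
  using flat_total_ge[of k] lower[of k] one_le_power[of "2::nat" k] by linarith

text \<open>
  The stretch has either only three doublings or a bounded total growth, and in both cases the
  complexity at its end lags behind \<open>F\<close> by at most a bounded power, that is, by a bounded
  shift of the exponent \<open>s\<close> in \<open>b ^ 2 ^ s\<close>.
\<close>
lemma F_flat_end_le: "F (flat_end k) \<le> flat_total k ^ 8"
  using flat_end_cases[of k]
proof
  assume "flat_end k = k + 3"
  then have "F (flat_end k) \<le> F k ^ 8" using iterated_square[of F k 3, OF square] by simp
  also have "\<dots> \<le> flat_total k ^ 8" using flat_total_ge[of k] by (intro power_mono) auto
  finally show ?thesis .
next
  let ?b = "flat_total k"
  assume "F (flat_end k) < 256 * F k"
  also have "\<dots> \<le> 8 * 8 * ?b" using flat_total_ge[of k] by simp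
  also have "\<dots> \<le> ?b * ?b * ?b" using flat_total_ge_8[of k] by (intro mult_le_mono) auto
  also have "\<dots> = ?b ^ 3" by (simp add: power3_eq_cube)
  also have "\<dots> \<le> ?b ^ 8" using flat_total_ge_8[of k] by (intro power_increasing) auto
  finally show ?thesis by simp
qed

text \<open>
  A growth step over \<open>j\<close> doublings has room for \<open>2 ^ (j - 2) - 1\<close> blocks, so the target \<open>F\<close> is within
  reach once it is at most \<open>b ^ 2 ^ (j - 4)\<close>, where \<open>b = flat_total k\<close>. The minimality of \<open>j\<close> forces \<open>F\<close>
  to grow like \<open>b ^ 2 ^ s\<close> throughout the step.
\<close>
definition jump :: "nat \<Rightarrow> nat" where
  "jump k = (LEAST j. 5 \<le> j \<and> F (flat_end k + j) \<le> flat_total k ^ 2 ^ (j - 4))"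

lemma jump_exists: "\<exists>j. 5 \<le> j \<and> F (flat_end k + j) \<le> flat_total k ^ 2 ^ (j - 4)"
proof -
  obtain s where s: "F (s + (flat_end k + 5)) < 2 ^ 2 ^ s" using subexponential by blast
  also have "(2::nat) ^ 2 ^ s \<le> flat_total k ^ 2 ^ s"
    using flat_total_ge_8[of k] by (intro power_mono) auto
  also have "\<dots> \<le> flat_total k ^ 2 ^ (s + 1)"
    using flat_total_ge_8[of k] by (intro power_increasing) auto
  finally show ?thesis by (intro exI[of _ "s + 5"]) (simp add: add.commute add.left_commute)
qed

lemma jump: "5 \<le> jump k" "F (flat_end k + jump k) \<le> flat_total k ^ 2 ^ (jump k - 4)"
  using LeastI_ex[OF jump_exists, of k] unfolding jump_def by auto

lemma before_jump:
  assumes "5 \<le> j" and "j < jump k"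
  shows "flat_total k ^ 2 ^ (j - 4) < F (flat_end k + j)"
  using not_less_Least[OF assms(2)[unfolded jump_def]] assms(1) by simp

definition next_scale :: "nat \<Rightarrow> nat" where
  "next_scale k = flat_end k + jump k"

lemma next_scale_gt: "k < next_scale k"
  using flat_end(1)[of k] jump(1)[of k] by (simp add: next_scale_def)

lemma pow_le_double_minus_one: "2 ^ s \<le> 2 ^ Suc s - (1::nat)"
  using one_le_power[of "2::nat" s] by simp

lemma cover_flat: "count k \<le> (2 ^ (flat_end k - (k + 2)) - 1) * flat_count k"
proof -
  have "flat_end k - (k + 2) = Suc (flat_end k - (k + 3))" using flat_end(1)[of k] by simp
  then have "2 ^ (flat_end k - (k + 3)) \<le> 2 ^ (flat_end k - (k + 2)) - (1::nat)"
    using pow_le_double_minus_one by metis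
  then show ?thesis using count_le_flat_count[of k] by (meson le_trans mult_le_mono1)
qed

lemma room_flat:
  assumes "0 < k"
  shows "flat_count k \<le> (2 ^ k * count k) ^ (2 ^ (flat_end k - (k + 2)) - 1)"
proof -
  have "flat_count k \<le> count k + 1" by (simp add: flat_count_def)
  also have "\<dots> \<le> 2 ^ 1 * count k" using count_pos[of k] by simp
  also have "\<dots> \<le> 2 ^ k * count k" using assms by (intro mult_le_mono1 power_increasing) auto
  also have "\<dots> \<le> (2 ^ k * count k) ^ (2 ^ (flat_end k - (k + 2)) - 1)"
  proof (rule self_le_power)
    show "1 \<le> 2 ^ k * count k" using count_pos[of k] by simp
    have "(2::nat) ^ 1 \<le> 2 ^ (flat_end k - (k + 2))"
      using flat_end(1)[of k] by (intro power_increasing) auto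
    then show "0 < 2 ^ (flat_end k - (k + 2)) - (1::nat)" by simp
  qed
  finally show ?thesis .
qed

text \<open>
  The cores at the end of the flat stretch can all be covered, since \<open>16 * b \<le> F\<close> at the next
  scale: of the two summands in \<open>flat_total_le\<close>, the first is small because \<open>F\<close> has grown by the
  factor 256, the second because the length has grown by the factor \<open>2 ^ 5\<close> at least.
\<close>
lemma cover_jump: "flat_count k \<le> (2 ^ (jump k - 2) - 1) * count (next_scale k)"
proof -
  let ?j = "jump k" and ?l = "next_scale k"
  have "16 * flat_total k \<le> 128 * F k + 16 * 2 ^ flat_end k" using flat_total_le[of k] by simp
  also have "128 * F k \<le> F ?l div 2"
  proof -
    have "256 * F k \<le> F ?l"
      using flat_end(2)[of k] F_mono[of "Suc (flat_end k)" ?l] jump(1)[of k]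
      by (simp add: next_scale_def)
    then show ?thesis by simp
  qed
  also have "16 * 2 ^ flat_end k \<le> F ?l div 2"
  proof -
    have "2 * (16 * 2 ^ flat_end k) = (2::nat) ^ (flat_end k + 5)" by (simp add: power_add)
    also have "\<dots> \<le> 2 ^ ?l" using jump(1)[of k] by (intro power_increasing) (auto simp: next_scale_def)
    also have "\<dots> \<le> F ?l" using lower[of ?l] by simp
    finally show ?thesis by simp
  qed
  finally have "16 * flat_total k \<le> F ?l" by simp
  also have "\<dots> \<le> 2 * (2 ^ ?l * count ?l)" by (rule count_ge)
  also have "(2::nat) ^ ?l = 2 ^ flat_end k * (8 * 2 ^ (?j - 3))"
  proof -
    have "?l = flat_end k + (3 + (?j - 3))" using jump(1)[of k] by (simp add: next_scale_def)
    then show ?thesis by (simp only: power_add) simp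
  qed
  finally have "2 ^ flat_end k * flat_count k \<le> 2 ^ flat_end k * (2 ^ (?j - 3) * count ?l)"
    by (simp add: flat_total_def)
  then have "flat_count k \<le> 2 ^ (?j - 3) * count ?l" by simp
  also have "\<dots> \<le> (2 ^ (?j - 2) - 1) * count ?l"
  proof (rule mult_le_mono1)
    have "?j - 2 = Suc (?j - 3)" using jump(1)[of k] by simp
    then show "2 ^ (?j - 3) \<le> 2 ^ (?j - 2) - (1::nat)" using pow_le_double_minus_one by metis
  qed
  finally show ?thesis .
qed

lemma room_jump: "count (next_scale k) \<le> flat_total k ^ (2 ^ (jump k - 2) - 1)"
proof -
  have "count (next_scale k) \<le> F (next_scale k)" by (simp add: count_def)
  also have "\<dots> \<le> flat_total k ^ 2 ^ (jump k - 4)" using jump(2) by (simp add: next_scale_def)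
  also have "\<dots> \<le> flat_total k ^ (2 ^ (jump k - 2) - 1)"
  proof (rule power_increasing)
    have "(2::nat) ^ (jump k - 4) \<le> 2 ^ (jump k - 3)" by (intro power_increasing) auto
    also have "\<dots> \<le> 2 ^ Suc (jump k - 3) - 1" by (rule pow_le_double_minus_one)
    also have "Suc (jump k - 3) = jump k - 2" using jump(1)[of k] by simp
    finally show "(2::nat) ^ (jump k - 4) \<le> 2 ^ (jump k - 2) - 1" .
    show "1 \<le> flat_total k" using flat_total_ge_8[of k] by simp
  qed
  finally show ?thesis .
qed

section \<open>Comparing the two growths\<close>

context
  fixes P :: "nat \<Rightarrow> nat" and k :: nat
  assumes P_step_mono: "\<And>l. P l \<le> P (Suc l)"
    and P_square: "\<And>l. P (Suc l) \<le> (P l)\<^sup>2"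
begin

lemma P_mono: "i \<le> j \<Longrightarrow> P i \<le> P j"
  by (rule lift_Suc_mono_le[of P]) (rule P_step_mono)

text \<open>
  On the flat stretch the complexity is at most its value at the end, which is bounded by a multiple
  of \<open>F k\<close>, or, if the stretch has only three doublings, of \<open>F (k + 3)\<close>. In the
  growth step the complexity is at most \<open>b ^ 2 ^ (s + 1)\<close> after \<open>s\<close> doublings, and \<open>F\<close> exceeds this value six doublings later, unless the step has ended by then.
\<close>
lemma upper_bound:
  assumes flat: "P (flat_end k) \<le> 3 * flat_total k"
    and next_le: "P (next_scale k) \<le> 3 * F (next_scale k)"
    and l: "k \<le> l" "l < next_scale k"
  shows "P l \<le> 792 * F (l + 6)"
proof (cases "l \<le> flat_end k")
  case True
  have "P l \<le> 3 * flat_total k" using P_mono[OF True] flat by simp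
  also have "\<dots> \<le> 24 * F k + 3 * 2 ^ flat_end k" using flat_total_le[of k] by simp
  also have "\<dots> \<le> 24 * F k + 3 * F (flat_end k)" using lower[of "flat_end k"] by simp
  also have "\<dots> \<le> 792 * F (l + 6)"
    using flat_end_cases[of k]
  proof
    assume "flat_end k = k + 3"
    then show ?thesis using F_mono[of k "l + 6"] F_mono[of "k + 3" "l + 6"] l(1) by simp
  next
    assume "F (flat_end k) < 256 * F k"
    then show ?thesis using F_mono[of k "l + 6"] l(1) by simp
  qed
  finally show ?thesis .
next
  case False
  show ?thesis
  proof (cases "next_scale k \<le> l + 6")
    case True
    have "P l \<le> 3 * F (next_scale k)" using P_mono[of l "next_scale k"] l(2) next_le by simp
    also have "\<dots> \<le> 792 * F (l + 6)" using F_mono[OF True] by simp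
    finally show ?thesis .
  next
    case less: False
    let ?b = "flat_total k"
    define s where "s = l - flat_end k"
    have s: "l = flat_end k + s" using False by (simp add: s_def)
    have "P l \<le> P (flat_end k) ^ 2 ^ s" unfolding s by (rule iterated_square[of P, OF P_square])
    also have "\<dots> \<le> (3 * ?b) ^ 2 ^ s" using flat by (rule power_mono) simp
    also have "\<dots> \<le> (?b\<^sup>2) ^ 2 ^ s"
      using flat_total_ge_8[of k] by (intro power_mono) (simp_all add: power2_eq_square)
    also have "\<dots> = ?b ^ 2 ^ (s + 1)" by (simp flip: power_mult)
    also have "\<dots> \<le> ?b ^ 2 ^ (s + 6 - 4)"
      using flat_total_ge_8[of k] by (intro power_increasing) auto
    also have "\<dots> < F (flat_end k + (s + 6))"
      using less s by (intro before_jump) (simp_all add: next_scale_def)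
    finally show ?thesis by (simp add: s add.assoc)
  qed
qed

text \<open>
  On the flat stretch, and shortly after it, \<open>F\<close> is bounded by a multiple of \<open>F k\<close> up to a shift. Later
  on, the many cores at the end of the growth step force the complexity to be large inside the step
  already, because doubling the length can at most square the complexity.
\<close>
lemma lower_bound:
  assumes start: "2 ^ k * count k \<le> P (Suc k)"
    and next_ge: "count (next_scale k) \<le> P (next_scale k)"
    and l: "k \<le> l" "l < next_scale k"
  shows "F (l - 12) \<le> 512 * P (l + 2)"
proof -
  let ?b = "flat_total k"
  have start': "F k \<le> 2 * P (l + 2)"
    using count_ge[of k] start P_mono[of "Suc k" "l + 2"] l(1) by simp
  show ?thesis
  proof (cases "l < flat_end k + 9")
    case True
    show ?thesis
      using flat_end_cases[of k]
    proof
      assume "flat_end k = k + 3"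
      then have "F (l - 12) \<le> F k" using True by (intro F_mono) simp
      then show ?thesis using start' by simp
    next
      assume "F (flat_end k) < 256 * F k"
      moreover have "F (l - 12) \<le> F (flat_end k)" using True by (intro F_mono) simp
      ultimately show ?thesis using start' by simp
    qed
  next
    case False
    define j where "j = jump k"
    have j: "10 \<le> j" "next_scale k = flat_end k + j"
      using False l(2) by (simp_all add: next_scale_def j_def)
    have b: "8 \<le> ?b" by (rule flat_total_ge_8)
    \<comment> \<open>The length \<open>2 ^ next_scale k\<close> is at most \<open>?b ^ (j + 2)\<close>, negligible against \<open>?b ^ 2 ^ (j - 5)\<close>,
        so dividing \<open>F\<close> by it costs at most a square root.\<close>
    have many: "?b ^ 2 ^ (j - 6) \<le> count (next_scale k)"
    proof -
      have "j + 2 \<le> 2 ^ (j - 6)"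
        using j(1)
      proof (induction j rule: dec_induct)
        case (step i)
        then have "Suc i - 6 = Suc (i - 6)" by simp
        then show ?case using step by simp
      qed simp
      then have pow: "?b ^ (j + 2) \<le> ?b ^ 2 ^ (j - 6)" using b by (intro power_increasing) auto
      have "?b ^ 2 ^ (j - 6) * ?b ^ 2 ^ (j - 6) = ?b ^ 2 ^ (j - 5)"
      proof -
        have "j - 5 = Suc (j - 6)" using j(1) by simp
        then show ?thesis by (simp add: mult_2 flip: power_add)
      qed
      also have "\<dots> = ?b ^ 2 ^ (j - 1 - 4)" by simp
      also have "\<dots> < F (flat_end k + (j - 1))"
        using j(1) by (intro before_jump) (simp_all add: j_def)
      also have "\<dots> \<le> F (next_scale k)" unfolding j(2) by (rule F_mono) simp
      also have "\<dots> \<le> 2 * (2 ^ next_scale k * count (next_scale k))" by (rule count_ge)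
      also have "\<dots> = 2 ^ flat_end k * 2 ^ (j + 1) * count (next_scale k)"
        by (simp add: j(2) power_add)
      also have "\<dots> \<le> ?b * ?b ^ (j + 1) * count (next_scale k)"
        using b by (intro mult_le_mono1 mult_le_mono power_mono) (simp_all add: flat_total_def flat_count_def)
      also have "\<dots> = ?b ^ (j + 2) * count (next_scale k)" by simp
      also have "\<dots> \<le> ?b ^ 2 ^ (j - 6) * count (next_scale k)" using pow by (rule mult_le_mono1)
      finally show ?thesis using b by simp
    qed
    define s where "s = l - flat_end k - 9"
    have s: "l = flat_end k + (s + 9)" using False by (simp add: s_def)
    define r where "r = next_scale k - l"
    have r: "next_scale k = l + r" "j - 6 = s + 3 + r" using l(2) j(2) s by (simp_all add: r_def)
    have "(?b ^ 2 ^ (s + 3)) ^ 2 ^ r = ?b ^ 2 ^ (j - 6)"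
      unfolding r(2) power_add[of _ "s + 3" r] by (simp only: power_mult)
    also have "\<dots> \<le> P (l + r)" using many next_ge r(1) by simp
    also have "\<dots> \<le> P l ^ 2 ^ r" by (rule iterated_square[of P, OF P_square])
    finally have "?b ^ 2 ^ (s + 3) \<le> P l" by (simp add: power_mono_iff)
    moreover have "F (flat_end k + s) \<le> ?b ^ 2 ^ (s + 3)"
    proof -
      have "F (flat_end k + s) \<le> F (flat_end k) ^ 2 ^ s" by (rule iterated_square[of F, OF square])
      also have "\<dots> \<le> (?b ^ 8) ^ 2 ^ s" using F_flat_end_le by (rule power_mono) simp
      also have "\<dots> = ?b ^ 2 ^ (s + 3)" by (simp add: power_add mult.commute flip: power_mult)
      finally show ?thesis .
    qed
    moreover have "F (l - 12) \<le> F (flat_end k + s)" by (rule F_mono) (simp add: s)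
    moreover have "P l \<le> P (l + 2)" by (rule P_mono) simp
    ultimately show ?thesis by simp
  qed
qed

end

end

section \<open>Words of prescribed growth\<close>
context growth
begin

primrec scale :: "nat \<Rightarrow> nat" where
  "scale 0 = 1"
| "scale (Suc i) = next_scale (scale i)"

lemma scale_pos: "0 < scale i"
  by (induction i) (use next_scale_gt in \<open>auto intro: less_trans\<close>)

lemma scale_ge: "i < scale i"
proof (induction i)
  case (Suc i)
  then show ?case using next_scale_gt[of "scale i"] by simp
qed simp

lemma scale_between:
  assumes "0 < l"
  obtains i where "scale i \<le> l" and "l < next_scale (scale i)"
proof -
  define i where "i = (LEAST i. l < scale (Suc i))"
  have "l < scale (Suc l)" using scale_ge[of "Suc l"] by simp
  then have "l < scale (Suc i)" unfolding i_def by (rule LeastI)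
  moreover have "scale i \<le> l"
  proof (cases i)
    case (Suc i')
    then have "i' < (LEAST i. l < scale (Suc i))" unfolding i_def by simp
    from not_less_Least[OF this] show ?thesis using Suc by simp
  qed (use assms in simp)
  ultimately show thesis using that by simp
qed

text \<open>
  Levels with even index are the scales at which the complexity is \<open>F\<close>; those with odd index are the ends
  of the flat stretches in between.
\<close>
theorem word_exists:
  obtains \<Sigma> :: "nat set" and w :: "nat word" where "finite \<Sigma>" and "range w \<subseteq> \<Sigma>" and "recurrent w"
    and "\<And>l. 0 < l \<Longrightarrow> complexity w (2 ^ l) \<le> 792 * F (l + 6)"
    and "\<And>l. 0 < l \<Longrightarrow> F (l - 12) \<le> 512 * complexity w (2 ^ (l + 2))"
proof -
  define n :: "nat \<Rightarrow> nat" where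
    "n i = 2 ^ (let k = scale (i div 2) in if even i then k else flat_end k)" for i
  define a where "a i = (let k = scale (i div 2) in if even i then count k else flat_count k)" for i
  define m :: "nat \<Rightarrow> nat" where
    "m i = (let k = scale (i div 2) in 2 ^ (if even i then flat_end k - (k + 2) else jump k - 2) - 1)" for i
  have even: "n (2 * i) = 2 ^ scale i" "a (2 * i) = count (scale i)"
    "m (2 * i) = 2 ^ (flat_end (scale i) - (scale i + 2)) - 1" for i
    by (simp_all add: n_def a_def m_def Let_def)
  have odd: "n (Suc (2 * i)) = 2 ^ flat_end (scale i)" "a (Suc (2 * i)) = flat_count (scale i)"
    "m (Suc (2 * i)) = 2 ^ (jump (scale i) - 2) - 1" for i
    by (simp_all add: n_def a_def m_def Let_def)
  have next_even: "n (Suc (Suc (2 * i))) = 2 ^ next_scale (scale i)"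
    "a (Suc (Suc (2 * i))) = count (next_scale (scale i))" for i
    by (simp_all add: n_def a_def Let_def)
  have cases: "Q i" if "\<And>l. Q (2 * l)" "\<And>l. Q (Suc (2 * l))" for Q and i :: nat
    using that by (metis evenE oddE Suc_eq_plus1)
  have "\<exists>(\<Sigma> :: nat set) (w :: nat word). finite \<Sigma> \<and> range w \<subseteq> \<Sigma> \<and> recurrent w \<and>
    (\<forall>i. complexity w (n i) \<le> 3 * (n i * a i) \<and>
      n i * a i \<le> complexity w (2 * n i) \<and> a i \<le> complexity w (n i))"
  proof (rule word_with_levels[of n m a])
    show "0 < n 0" by (simp add: n_def Let_def)
    show "n (Suc i) = 4 * n i * (m i + 1)" for i
    proof (rule cases[of "\<lambda>i. n (Suc i) = 4 * n i * (m i + 1)"])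
      fix l
      let ?k = "scale l"
      have "?k + 2 \<le> flat_end ?k" "2 \<le> jump ?k" using flat_end(1)[of ?k] jump(1)[of ?k] by simp_all
      then obtain t u where t: "flat_end ?k = ?k + 2 + t" and u: "jump ?k = 2 + u"
        by (metis le_Suc_ex)
      show "n (Suc (2 * l)) = 4 * n (2 * l) * (m (2 * l) + 1)"
        unfolding odd even by (simp add: t power_add)
      show "n (Suc (Suc (2 * l))) = 4 * n (Suc (2 * l)) * (m (Suc (2 * l)) + 1)"
        unfolding odd next_even by (simp add: next_scale_def u power_add)
    qed
    show "0 < a i" for i
      using count_pos by (simp add: a_def Let_def flat_count_def)
    show "a i \<le> m i * a (Suc i)" for i
      by (rule cases[of "\<lambda>i. a i \<le> m i * a (Suc i)"])
        (simp_all only: even odd next_even cover_flat cover_jump)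
    show "a (Suc i) \<le> (n i * a i) ^ m i" for i
      by (rule cases[of "\<lambda>i. a (Suc i) \<le> (n i * a i) ^ m i"])
        (simp_all only: even odd next_even room_flat scale_pos room_jump flip: flat_total_def)
  qed
  then obtain \<Sigma> :: "nat set" and w :: "nat word"
    where fin: "finite \<Sigma>" and alph: "range w \<subseteq> \<Sigma>" and rec: "recurrent w"
    and levels: "\<forall>i. complexity w (n i) \<le> 3 * (n i * a i) \<and>
      n i * a i \<le> complexity w (2 * n i) \<and> a i \<le> complexity w (n i)"
    by blast
  have upper: "complexity w (n i) \<le> 3 * (n i * a i)"
    and start: "n i * a i \<le> complexity w (2 * n i)"
    and many: "a i \<le> complexity w (n i)" for i
    using levels by blast+
  define P where "P l = complexity w (2 ^ l)" for l
  have P_mono: "P l \<le> P (Suc l)" for l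
    unfolding P_def by (rule monoD[OF mono_complexity[OF fin alph]]) simp
  have P_square: "P (Suc l) \<le> (P l)\<^sup>2" for l
    unfolding P_def using complexity_double[OF fin alph] by simp
  have bounds: "P l \<le> 792 * F (l + 6) \<and> F (l - 12) \<le> 512 * P (l + 2)" if "0 < l" for l
  proof -
    obtain i where i: "scale i \<le> l" "l < next_scale (scale i)" using \<open>0 < l\<close> by (rule scale_between)
    let ?k = "scale i"
    have 1: "P (flat_end ?k) \<le> 3 * flat_total ?k"
      using upper[of "Suc (2 * i)"] by (simp add: odd P_def flat_total_def)
    have "P (next_scale ?k) \<le> 3 * (2 ^ next_scale ?k * count (next_scale ?k))"
      using upper[of "Suc (Suc (2 * i))"] by (simp only: next_even P_def)
    then have 2: "P (next_scale ?k) \<le> 3 * F (next_scale ?k)"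
      using count_le[of "next_scale ?k"] by linarith
    have 3: "2 ^ ?k * count ?k \<le> P (Suc ?k)" using start[of "2 * i"] by (simp add: even P_def)
    have 4: "count (next_scale ?k) \<le> P (next_scale ?k)"
      using many[of "Suc (Suc (2 * i))"] by (simp only: next_even P_def)
    show ?thesis
      using upper_bound[of P, OF P_mono P_square 1 2 i] lower_bound[of P, OF P_mono P_square 3 4 i] by blast
  qed
  show thesis
    by (rule that[OF fin alph rec]) (use bounds in \<open>auto simp: P_def\<close>)
qed

end

lemma power_two_sandwich:
  fixes n :: nat
  assumes "0 < n"
  obtains s where "2 ^ s \<le> n" and "n \<le> 2 ^ Suc s"
  using ex_power_ivl1[of 2 n] assms by (auto intro: less_imp_le)

text \<open>
  The shift \<open>d\<close> in the exponent becomes the constant factor \<open>2 ^ d\<close> in the argument; the value at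
  0, which lies below all powers of 2, is absorbed into the other constant.
\<close>
lemma growth_le_from_powers:
  assumes "mono g" and "mono h" and "\<And>s. g (2 ^ Suc s) \<le> C * h (2 ^ (s + d))" and "0 < h 0"
  shows "g \<preceq> h"
proof -
  have "real (g n) \<le> real (C + g 0 + 1) * real (h (2 ^ d * n))" for n
  proof -
    have "g n \<le> (C + g 0 + 1) * h (2 ^ d * n)"
    proof (cases "n = 0")
      case True
      have "g 0 * 1 \<le> (C + g 0 + 1) * h 0" using \<open>0 < h 0\<close> by (intro mult_le_mono) auto
      then show ?thesis using True by simp
    next
      case False
      then obtain s where s: "2 ^ s \<le> n" "n \<le> 2 ^ Suc s" by (metis power_two_sandwich gr0I)
      have "g n \<le> g (2 ^ Suc s)" using s(2) by (rule monoD[OF \<open>mono g\<close>])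
      also have "\<dots> \<le> C * h (2 ^ (s + d))" by (rule assms(3))
      also have "\<dots> \<le> (C + g 0 + 1) * h (2 ^ d * n)"
      proof (rule mult_le_mono)
        have "2 ^ (s + d) \<le> 2 ^ d * n" using s(1) by (simp add: power_add)
        then show "h (2 ^ (s + d)) \<le> h (2 ^ d * n)" by (rule monoD[OF \<open>mono h\<close>])
      qed simp
      finally show ?thesis .
    qed
    then show ?thesis by (metis of_nat_le_iff of_nat_mult)
  qed
  then show ?thesis
    unfolding growth_le_def by (intro exI[of _ "real (C + g 0 + 1)"] exI[of _ "2 ^ d"]) auto
qed

lemma complexity_0: "complexity w 0 = 1"
proof -
  have "factors_of_length w 0 = {[]}" by (auto simp: factors_of_length_def)
  then show ?thesis by (simp add: complexity_def)
qed

theorem theorem1p1: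
  fixes f :: "nat \<Rightarrow> nat"
  assumes "mono f"
    and "\<And>n. f n \<ge> n + 1"
    and "\<And>n. f (2 * n) \<le> (f n)^2"
  shows "\<exists>(\<Sigma> :: nat set) (w :: nat word).
    finite \<Sigma> \<and> range w \<subseteq> \<Sigma> \<and> f \<sim> complexity w \<and> recurrent w"
proof -
  define F where "F k = f (2 ^ k)" for k
  have F_square: "F (Suc k) \<le> (F k)\<^sup>2" for k
    unfolding F_def using assms(3)[of "2 ^ k"] by simp
  have F_mono: "F k \<le> F l" if "k \<le> l" for k l
    unfolding F_def using that by (intro monoD[OF assms(1)] power_increasing) auto
  have F_lower: "2 ^ k < F k" for k
    unfolding F_def using assms(2)[of "2 ^ k"] by simp
  have f0: "0 < f 0" using assms(2)[of 0] by simp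
  have comp0: "0 < complexity w 0" for w :: "nat word" by (simp add: complexity_0)
  show ?thesis
  proof (cases "\<exists>c. \<forall>s. 2 ^ 2 ^ s \<le> F (s + c)")
    case True
    then obtain c where c: "\<And>s. 2 ^ 2 ^ s \<le> F (s + c)" by blast
    obtain w :: "nat word" where w: "range w \<subseteq> {0, 1}" "recurrent w" "\<And>n. complexity w n = 2 ^ n"
      by (rule full_binary_word) (rule that)
    have mono: "mono (complexity w)" by (rule mono_complexity[OF _ w(1)]) simp
    have "f \<preceq> complexity w"
    proof (rule growth_le_from_powers[where C = 1 and d = "F 0 + 1"])
      fix s
      have "f (2 ^ Suc s) \<le> F 0 ^ 2 ^ Suc s"
        using iterated_square[of F 0 "Suc s", OF F_square] by (simp add: F_def)
      \<comment> \<open>The base \<open>f 1\<close> is arbitrary; bounding it by a power of 2 stretches the argument.\<close>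
      also have "\<dots> \<le> (2 ^ 2 ^ F 0) ^ 2 ^ Suc s"
      proof (rule power_mono)
        have "F 0 < 2 ^ F 0" by (rule less_exp)
        also have "(2::nat) ^ F 0 < 2 ^ 2 ^ F 0" by (intro power_strict_increasing less_exp) simp
        finally show "F 0 \<le> 2 ^ 2 ^ F 0" by simp
      qed simp
      also have "\<dots> = 2 ^ 2 ^ (s + (F 0 + 1))" by (simp add: power_add mult.commute flip: power_mult)
      finally show "f (2 ^ Suc s) \<le> 1 * complexity w (2 ^ (s + (F 0 + 1)))" unfolding w(3) by simp
    qed (fact assms(1) mono comp0)+
    moreover have "complexity w \<preceq> f"
    proof (rule growth_le_from_powers[where C = 1 and d = "c + 1"])
      show "complexity w (2 ^ Suc s) \<le> 1 * f (2 ^ (s + (c + 1)))" for s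
        using c[of "Suc s"] unfolding w(3) F_def by simp
    qed (fact assms(1) mono f0)+
    ultimately show ?thesis
      using w by (intro exI[of _ "{0, 1}"] exI[of _ w]) (simp add: growth_equiv_def)
  next
    case False
    interpret growth F
    proof
      show "\<exists>s. F (s + c) < 2 ^ 2 ^ s" for c using False by (meson not_le)
    qed (use F_mono F_square F_lower in auto)
    obtain \<Sigma> :: "nat set" and w :: "nat word" where fin: "finite \<Sigma>" and alph: "range w \<subseteq> \<Sigma>" and rec: "recurrent w"
      and upper: "\<And>l. 0 < l \<Longrightarrow> complexity w (2 ^ l) \<le> 792 * F (l + 6)"
      and lower': "\<And>l. 0 < l \<Longrightarrow> F (l - 12) \<le> 512 * complexity w (2 ^ (l + 2))"
      by (rule word_exists) (rule that)
    have mono: "mono (complexity w)" by (rule mono_complexity[OF fin alph])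
    have "f \<preceq> complexity w"
    proof (rule growth_le_from_powers[where C = 512 and d = 15])
      show "f (2 ^ Suc s) \<le> 512 * complexity w (2 ^ (s + 15))" for s
        using lower'[of "s + 13"] by (simp add: F_def add.commute)
    qed (fact assms(1) mono comp0)+
    moreover have "complexity w \<preceq> f"
    proof (rule growth_le_from_powers[where C = 792 and d = 7])
      show "complexity w (2 ^ Suc s) \<le> 792 * f (2 ^ (s + 7))" for s
        using upper[of "Suc s"] by (simp add: F_def add.commute)
    qed (fact assms(1) mono f0)+
    ultimately show ?thesis using fin alph rec unfolding growth_equiv_def by blast
  qed
qed

end
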